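(* If $c\geq 2$, then $\mathit{fw}(I_{c}D_{c}I_{c})=c+3$.
   Context: A sequence $s$ contains a sequence $u$ if some subsequence of $s$ can be changed into $u$ by a one-to-one renaming of its letters. An $(r,s)$-formation is a concatenation of $s$ permutations of the same set of $r$ distinct letters. The formation width $\mathit{fw}(u)$ is the minimum $s$ such that there exists $r$ for which every $(r,s)$-formation contains $u$. $I_c$ denotes $1\,2\ldots c$ and $D_c$ denotes $c\,(c-1)\ldots 1$. *)

theory Defs
  imports
    "HOL-Library.Sublist"
    "HOL-Library.Extended_Nat"
    "HOL-Combinatorics.Multiset_Permutations"
begin

definition seq_contains :: "'a list \<Rightarrow> 'b list \<Rightarrow> bool" where
  "seq_contains s u \<longleftrightarrow> (\<exists>t f. subseq t s \<and> inj_on f (set t) \<and> map f t = u)"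

text \<open>
  Letters of formations are natural numbers. Being an infinite alphabet, they supply
  \<^term>\<open>r\<close> distinct letters for every \<^term>\<open>r\<close>, so no quantification over
  formations is vacuous.
\<close>

definition is_formation :: "nat \<Rightarrow> nat \<Rightarrow> nat list \<Rightarrow> bool" where
  "is_formation r s w \<longleftrightarrow>
     (\<exists>A ps. finite A \<and> card A = r \<and> length ps = s \<and>
             set ps \<subseteq> permutations_of_set A \<and> w = concat ps)"

text \<open>
  The minimum is taken in the extended naturals: every nonempty set of these has a least
  element, which is its infimum, and the infimum of the empty set is \<^term>\<open>\<infinity>\<close>. A finite
  value therefore asserts that the minimum exists.
\<close>

definition fw :: "'a list \<Rightarrow> enat" where
  "fw u = Inf {enat s | s. \<exists>r. \<forall>w. is_formation r s w \<longrightarrow> seq_contains w u}"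

definition I_seq :: "nat \<Rightarrow> nat list" where
  "I_seq c = [1..<c + 1]"

definition D_seq :: "nat \<Rightarrow> nat list" where
  "D_seq c = rev [1..<c + 1]"

end

theory Submission
  imports Defs "HOL-Library.Ramsey"
begin

text \<open>
  Upper bound: by Ramsey's theorem, a formation on sufficiently many letters contains a list
  \<open>q\<close> of \<open>c\<close> letters such that each of its \<open>c + 3\<close> permutations contains \<open>q\<close> or \<open>rev q\<close>. The
  pattern of forward and backward blocks may be assumed to start with a forward one. If a forward
  block follows a backward one, then \<open>q\<close>, \<open>rev q\<close>, \<open>q\<close> can be read off. Otherwise the pattern
  consists of \<open>i\<close> forward blocks followed by \<open>j\<close> backward ones, and reading the letters
  in a unimodal order with \<open>i - 2\<close> descents works when \<open>i\<close> and \<open>j\<close> are at least 2; if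
  one of them is smaller, the other is at least \<open>c + 2\<close> and a monotone order works.

  Lower bound: two increasing permutations followed by \<open>c\<close> decreasing ones avoid the word. A list
  contained in \<open>c\<close> decreasing blocks has at most \<open>c - 1\<close> adjacent pairs that are not descending,
  whereas \<open>rev p @ p\<close> has exactly \<open>c\<close> of them for every ordering \<open>p\<close> of \<open>c\<close> letters.
\<close>

section \<open>Monotone restrictions of formations\<close>

lemma subseq_set_subset: "subseq xs ys \<Longrightarrow> set xs \<subseteq> set ys"
  by (induction rule: list_emb.induct) auto

lemma sorted_wrt_subseq_pair: "sorted_wrt (\<lambda>x y. subseq [x, y] q) q"
proof (induction q)
  case (Cons a q)
  then have "sorted_wrt (\<lambda>x y. subseq [x, y] (a # q)) q"
    by (rule sorted_wrt_mono_rel[rotated]) (simp only: list_emb_Cons)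
  moreover have "subseq [a, y] (a # q)" if "y \<in> set q" for y
    using that by (simp add: subseq_singleton_left)
  ultimately show ?case
    by auto
qed simp

lemma subseq_pair_total:
  assumes "x \<in> set p" "y \<in> set p" "x \<noteq> y"
  shows "subseq [x, y] p \<or> subseq [y, x] p"
  using assms by (induction p) (auto simp: subseq_singleton_left)

lemma subseq_pair_asym:
  assumes "distinct q" "subseq [x, y] q"
  shows "\<not> subseq [y, x] q"
  using assms
  by (induction q) (auto simp: subseq_singleton_left split: if_splits dest: subseq_set_subset)

text \<open>Reduces the embedding of a whole list to the order of pairs, which is all that Ramsey's
  theorem for graphs controls.\<close>

lemma subseq_if_sorted_wrt_pairs:
  assumes "sorted_wrt (\<lambda>x y. subseq [x, y] p) q" "set q \<subseteq> set p" "distinct p" "distinct q"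
  shows "subseq q p"
  using assms
proof (induction p arbitrary: q)
  case (Cons a p)
  show ?case
  proof (cases q)
    case q: (Cons b q')
    have memb: "y \<in> set p \<and> y \<noteq> a" if "y \<in> set q'" for y
    proof -
      have "subseq [b, y] (a # p)"
        using Cons.prems(1) q that by simp
      then have "y \<in> set p"
        by (auto simp: subseq_singleton_left split: if_splits dest: subseq_set_subset)
      then show ?thesis
        using Cons.prems(3) by auto
    qed
    have "sorted_wrt (\<lambda>x y. subseq [x, y] (a # p)) q'"
      using Cons.prems(1) q by simp
    then have srt: "sorted_wrt (\<lambda>x y. subseq [x, y] p) q'"
      by (rule sorted_wrt_mono_rel[rotated]) (use memb in auto)
    show ?thesis
    proof (cases "a = b")
      case True
      have "subseq q' p"
        using Cons.prems(3,4) q by (intro Cons.IH srt) (auto dest: memb)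
      then show ?thesis
        unfolding q True by (rule subseq_Cons2)
    next
      case False
      have "\<forall>y\<in>set q'. subseq [b, y] p"
        using Cons.prems(1) q False by simp
      then have "sorted_wrt (\<lambda>x y. subseq [x, y] p) q"
        using srt q by simp
      moreover have "set q \<subseteq> set p"
        using Cons.prems(2) q False memb by auto
      ultimately have "subseq q p"
        using Cons.prems(3,4) by (intro Cons.IH) auto
      then show ?thesis
        by (rule list_emb_Cons)
    qed
  qed simp
qed simp

text \<open>Each permutation costs one application of Ramsey's theorem: the induction hypothesis is
  invoked for a list of Ramsey-number length \<open>N\<close>, which is then thinned out to agree
  with the remaining permutation or to reverse it.\<close>

lemma monotone_restriction:
  "\<exists>r. \<forall>(A::'a set) ps. finite A \<longrightarrow> r \<le> card A \<longrightarrow> length ps = s \<longrightarrow> set ps \<subseteq> permutations_of_set A \<longrightarrow>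
    (\<exists>q. distinct q \<and> length q = n \<and> set q \<subseteq> A \<and> (\<forall>p\<in>set ps. subseq q p \<or> subseq (rev q) p))"
proof (induction s arbitrary: n)
  case 0
  show ?case
  proof (intro exI[of _ n] allI impI)
    fix A :: "'a set" and ps :: "'a list list"
    assume A: "finite A" "n \<le> card A" "length ps = 0"
    obtain xs where xs: "set xs = A" "distinct xs"
      using finite_distinct_list[OF A(1)] by blast
    then have "length (take n xs) = n"
      using A by (simp add: distinct_card[symmetric])
    then show "\<exists>q. distinct q \<and> length q = n \<and> set q \<subseteq> A \<and> (\<forall>p\<in>set ps. subseq q p \<or> subseq (rev q) p)"
      using xs A by (intro exI[of _ "take n xs"]) (auto dest: in_set_takeD)
  qed
next
  case (Suc s)
  obtain N where N: "\<And>(V::'a set) E. finite V \<Longrightarrow> card V \<ge> N \<Longrightarrow>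
      \<exists>R \<subseteq> V. card R = n \<and> clique R E \<or> card R = n \<and> indep R E"
    using ramsey2[where 'a = 'a, of n n] by metis
  obtain r where r: "\<And>(A::'a set) ps. finite A \<Longrightarrow> r \<le> card A \<Longrightarrow> length ps = s \<Longrightarrow>
      set ps \<subseteq> permutations_of_set A \<Longrightarrow>
      \<exists>q. distinct q \<and> length q = N \<and> set q \<subseteq> A \<and> (\<forall>p\<in>set ps. subseq q p \<or> subseq (rev q) p)"
    using Suc.IH[of N] by metis
  show ?case
  proof (intro exI[of _ r] allI impI)
    fix A :: "'a set" and ps :: "'a list list"
    assume A: "finite A" "r \<le> card A" "length ps = Suc s" "set ps \<subseteq> permutations_of_set A"
    obtain p ps' where ps: "ps = p # ps'"
      using A(3) by (cases ps) auto
    obtain q where q: "distinct q" "length q = N" "set q \<subseteq> A"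
      "\<forall>p\<in>set ps'. subseq q p \<or> subseq (rev q) p"
      using r[of A ps'] A ps by auto
    have p: "distinct p" "set p = A"
      using A(4) ps by (auto simp: permutations_of_set_def)
    \<comment> \<open>Edges are the pairs ordered alike by \<open>q\<close> and \<open>p\<close>: a
      clique yields a forward copy, an independent set a backward one.\<close>
    define E where "E = {{x, y} | x y. subseq [x, y] q \<and> subseq [x, y] p}"
    obtain R where R: "R \<subseteq> set q" "card R = n" "clique R E \<or> indep R E"
      using N[of "set q" E] q by (auto simp: distinct_card)
    define q' where "q' = filter (\<lambda>x. x \<in> R) q"
    have q': "distinct q'" "set q' = R" "subseq q' q" "subseq (rev q') (rev q)"
      using R q by (auto simp: q'_def rev_filter)
    have len: "length q' = n"
      using q' R distinct_card by metis
    have pairs: "sorted_wrt (\<lambda>x y. subseq [x, y] q) q'"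
      unfolding q'_def by (intro sorted_wrt_filter sorted_wrt_subseq_pair)
    have neq: "x \<noteq> y" if "subseq [x, y] q" for x y
      using that subseq_pair_asym q(1) by metis
    have "subseq q' p \<or> subseq (rev q') p"
      using R(3)
    proof
      assume cl: "clique R E"
      have "subseq [x, y] p" if "x \<in> set q'" "y \<in> set q'" "subseq [x, y] q" for x y
      proof -
        have "{x, y} \<in> E"
          using cl that q' neq by (auto simp: clique_def)
        \<comment> \<open>Edges are unordered, so it has to be excluded that this one stems from
          \<open>[y, x]\<close>.\<close>
        then show ?thesis
          using subseq_pair_asym[OF q(1) that(3)] by (auto simp: E_def doubleton_eq_iff)
      qed
      then have "sorted_wrt (\<lambda>x y. subseq [x, y] p) q'"
        using pairs by (rule sorted_wrt_mono_rel)
      then show ?thesis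
        using subseq_if_sorted_wrt_pairs p q' q R by blast
    next
      assume ind: "indep R E"
      have "subseq [y, x] p" if "x \<in> set q'" "y \<in> set q'" "subseq [x, y] q" for x y
      proof -
        have "{x, y} \<notin> E"
          using ind that q' neq by (auto simp: indep_def)
        then have "\<not> subseq [x, y] p"
          using that(3) by (auto simp: E_def)
        then show ?thesis
          using subseq_pair_total[of x p y] neq[OF that(3)] that q' R q p by blast
      qed
      then have "sorted_wrt (\<lambda>x y. subseq [y, x] p) q'"
        using pairs by (rule sorted_wrt_mono_rel)
      then have "sorted_wrt (\<lambda>x y. subseq [x, y] p) (rev q')"
        by (simp add: sorted_wrt_rev)
      moreover have "set (rev q') \<subseteq> set p" "distinct (rev q')"
        using q' R q p by auto
      ultimately have "subseq (rev q') p"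
        using subseq_if_sorted_wrt_pairs p(1) by blast
      then show ?thesis ..
    qed
    moreover have "subseq q' p' \<or> subseq (rev q') p'" if "p' \<in> set ps'" for p'
      using q(4) q' that subseq_order.order_trans by blast
    ultimately show "\<exists>q. distinct q \<and> length q = n \<and> set q \<subseteq> A \<and> (\<forall>p\<in>set ps. subseq q p \<or> subseq (rev q) p)"
      using q' len R q ps by (intro exI[of _ q']) auto
  qed
qed

section \<open>Reading the word in a binary formation\<close>

lemma subseq_concat_mono:
  assumes "list_all2 subseq xss yss"
  shows "subseq (concat xss) (concat yss)"
  using assms by (induction rule: list_all2_induct) (simp_all add: list_emb_append_mono)

text \<open>One letter is taken from each block, so the order inside \<open>b\<close> does not
  matter.\<close>

lemma subseq_concat_replicate:
  assumes "set v \<subseteq> set b" "length v \<le> m"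
  shows "subseq v (concat (replicate m b))"
  using assms
proof (induction v arbitrary: m)
  case (Cons x v)
  then obtain m' where m: "m = Suc m'" "length v \<le> m'"
    by (cases m) auto
  have "subseq ([x] @ v) (b @ concat (replicate m' b))"
    using Cons m by (intro list_emb_append_mono) (auto simp: subseq_singleton_left)
  then show ?case
    using m by simp
qed simp

lemma bool_list_cases:
  "(\<exists>xs ys zs. w = xs @ False # ys @ True # zs) \<or> (\<exists>i j. w = replicate i True @ replicate j False)"
proof (induction w)
  case Nil
  have "[] = replicate 0 True @ replicate 0 False"
    by simp
  then show ?case
    by blast
next
  case (Cons a w)
  consider "a" | "\<not> a" "True \<in> set w" | "\<not> a" "True \<notin> set w"
    by blast
  then show ?case
  proof cases
    case 1
    from Cons show ?thesis
    proof (elim disjE exE)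
      fix xs ys zs
      assume "w = xs @ False # ys @ True # zs"
      then have "a # w = (a # xs) @ False # ys @ True # zs"
        by simp
      then show ?thesis
        by blast
    next
      fix i j
      assume "w = replicate i True @ replicate j False"
      then have "a # w = replicate (Suc i) True @ replicate j False"
        using 1 by simp
      then show ?thesis
        by blast
    qed
  next
    case 2
    then obtain ys zs where "w = ys @ True # zs"
      using split_list by fastforce
    then have "a # w = [] @ False # ys @ True # zs"
      using 2 by simp
    then show ?thesis
      by blast
  next
    case 3
    then have "\<forall>b\<in>set w. b = False"
      by auto
    then have "replicate (length w) False = w"
      by (rule replicate_length_same)
    then have "a # w = replicate 0 True @ replicate (Suc (length w)) False"
      using 3 by simp
    then show ?thesis
      by blast
  qed
qed

definition binary_formation :: "'a list \<Rightarrow> bool list \<Rightarrow> 'a list" where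
  "binary_formation q w = concat (map (\<lambda>b. if b then q else rev q) w)"

lemma binary_formation_simps [simp]:
  "binary_formation q [] = []"
  "binary_formation q (b # w) = (if b then q else rev q) @ binary_formation q w"
  "binary_formation q (w @ w') = binary_formation q w @ binary_formation q w'"
  "binary_formation q (replicate m b) = concat (replicate m (if b then q else rev q))"
  by (auto simp: binary_formation_def)

text \<open>This symmetry allows the first block to be taken forward.\<close>

lemma binary_formation_rev: "binary_formation (rev q) (map Not w) = binary_formation q w"
  by (auto simp: binary_formation_def comp_def intro!: arg_cong[where f = concat])

text \<open>The two outer blocks give the copies of \<open>q\<close>; the inner ones give
  \<open>rev q\<close> letter by letter.\<close>

lemma constant_blocks:
  assumes "m \<ge> length q + 2"
  shows "subseq (q @ rev q @ q) (concat (replicate m q))"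
proof -
  define k where "k = m - (length q + 2)"
  then have m: "m = 1 + (length q + k) + 1"
    using assms by simp
  have "subseq (rev q) (concat (replicate (length q + k) q))"
    by (intro subseq_concat_replicate) auto
  then have "subseq (q @ rev q @ q) (q @ concat (replicate (length q + k) q) @ q)"
    by (intro list_emb_append_mono) auto
  then show ?thesis
    unfolding m replicate_add by (simp add: replicate_add)
qed

text \<open>
  With \<open>q = A @ B @ [b]\<close> and \<open>t = A @ b # rev B\<close>, the forward blocks carry \<open>A @ [b]\<close>, the
  letters of \<open>rev B\<close> one by one, and \<open>B @ [b]\<close>; the backward blocks carry \<open>rev A\<close>, the letters of
  \<open>A\<close> one by one, and \<open>b # rev B\<close>.
\<close>
lemma unimodal_reading:
  assumes "q \<noteq> []" "i + j = length q + 3" "i \<ge> 2" "j \<ge> 2"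
  shows "\<exists>t. mset t = mset q \<and>
    subseq (t @ rev t @ t) (binary_formation q (replicate i True @ replicate j False))"
proof -
  \<comment> \<open>Since \<open>length (butlast q) = (i - 2) + (j - 2)\<close>, this cut gives
    \<open>A\<close> length \<open>j - 2\<close> and \<open>B\<close> length
    \<open>i - 2\<close>.\<close>
  define A where "A = take (j - 2) (butlast q)"
  define B where "B = drop (j - 2) (butlast q)"
  define b where "b = last q"
  have q: "q = A @ B @ [b]"
    using assms(1) by (simp add: A_def B_def b_def flip: append_assoc)
  have ij: "i = 1 + length B + 1" "j = 1 + length A + 1"
    using assms by (auto simp: A_def B_def)
  define t where "t = A @ b # rev B"
  have "subseq (rev B) (concat (replicate (length B) q))"
    "subseq A (concat (replicate (length A) (rev q)))"
    by (intro subseq_concat_replicate; auto simp: q)+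
  moreover have "subseq (A @ [b]) q" "subseq (B @ [b]) q" "subseq (rev A) (rev q)"
    "subseq (b # rev B) (rev q)"
    by (auto simp: q intro: list_emb_append_mono)
  ultimately have "subseq ((A @ [b]) @ rev B @ (B @ [b]) @ rev A @ A @ (b # rev B))
     (q @ concat (replicate (length B) q) @ q @ rev q @ concat (replicate (length A) (rev q)) @ rev q)"
    by (intro list_emb_append_mono)
  moreover have "mset t = mset q"
    by (simp add: t_def q)
  ultimately show ?thesis
    unfolding ij replicate_add binary_formation_simps
    by (intro exI[of _ t]) (simp add: t_def)
qed

lemma binary_formation_contains_if_hd:
  assumes "length w = length q + 3" "q \<noteq> []" "hd w"
  shows "\<exists>t. mset t = mset q \<and> subseq (t @ rev t @ t) (binary_formation q w)"
  using bool_list_cases[of w]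
proof (elim disjE exE)
  fix xs ys zs
  assume w: "w = xs @ False # ys @ True # zs"
  with assms(3) obtain xs' where "xs = True # xs'"
    by (cases xs) auto
  \<comment> \<open>The empty lists match the blocks that are skipped.\<close>
  moreover have "subseq (q @ [] @ rev q @ [] @ q @ [])
      (q @ binary_formation q xs' @ rev q @ binary_formation q ys @ q @ binary_formation q zs)"
    by (intro list_emb_append_mono) auto
  ultimately have "subseq (q @ rev q @ q) (binary_formation q w)"
    using w by simp
  then show ?thesis
    by blast
next
  fix i j
  assume w: "w = replicate i True @ replicate j False"
  then have ij: "i + j = length q + 3"
    using assms(1) by simp
  have "i \<ge> 1"
    using assms ij w by (cases i) (auto simp: hd_append)
  then consider "i \<ge> length q + 2" | "j \<ge> length q + 2" | "i \<ge> 2" "j \<ge> 2"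
    using ij by linarith
  then show ?thesis
  proof cases
    case 1
    then have "subseq (q @ rev q @ q) (binary_formation q w)"
      unfolding w by (auto intro!: subseq_rev_drop_many constant_blocks)
    then show ?thesis
      by blast
  next
    case 2
    \<comment> \<open>With \<open>t = rev q\<close>, the backward blocks are copies of
      \<open>t\<close> itself.\<close>
    then have "subseq (rev q @ rev (rev q) @ rev q) (binary_formation q w)"
      unfolding w binary_formation_simps if_False
      by (intro subseq_drop_many constant_blocks) simp
    then show ?thesis
      by (metis mset_rev)
  next
    case 3
    then show ?thesis
      using unimodal_reading assms ij w by blast
  qed
qed

lemma binary_formation_contains:
  assumes "length w = length q + 3" "q \<noteq> []"
  shows "\<exists>t. mset t = mset q \<and> subseq (t @ rev t @ t) (binary_formation q w)"
proof (cases "hd w")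
  case True
  then show ?thesis
    using assms by (intro binary_formation_contains_if_hd)
next
  case False
  moreover have "w \<noteq> []"
    using assms by auto
  ultimately have "\<exists>t. mset t = mset (rev q) \<and>
      subseq (t @ rev t @ t) (binary_formation (rev q) (map Not w))"
    using assms by (intro binary_formation_contains_if_hd) (auto simp: hd_map)
  then show ?thesis
    by (simp add: binary_formation_rev)
qed

section \<open>Counting breaks\<close>

text \<open>Equal neighbours break both \<open><\<close> and \<open>>\<close>; this matters at the
  turning points of \<open>p @ rev p @ p\<close>.\<close>

fun breaks :: "('a \<Rightarrow> 'a \<Rightarrow> bool) \<Rightarrow> 'a list \<Rightarrow> nat" where
  "breaks R (x # y # zs) = (if R x y then 0 else 1) + breaks R (y # zs)"
| "breaks R _ = 0"

lemma breaks_append: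
  assumes "xs \<noteq> []" "ys \<noteq> []"
  shows "breaks R (xs @ ys) = breaks R xs + (if R (last xs) (hd ys) then 0 else 1) + breaks R ys"
  using assms
proof (induction R xs rule: breaks.induct)
  case ("2_2" R x)
  then show ?case
    by (cases ys) auto
qed auto

lemma breaks_append_ge: "breaks R xs + breaks R ys \<le> breaks R (xs @ ys)"
  by (cases "xs = [] \<or> ys = []") (auto simp: breaks_append)

lemma breaks_append_le: "breaks R (xs @ ys) \<le> breaks R xs + 1 + breaks R ys"
  by (cases "xs = [] \<or> ys = []") (auto simp: breaks_append)

lemma breaks_rev: "breaks R (rev xs) = breaks (\<lambda>x y. R y x) xs"
  by (induction R xs rule: breaks.induct) (auto simp: breaks_append simp flip: append_assoc)

text \<open>Each of the \<open>length xs - 1\<close> adjacent pairs breaks exactly one of the two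
  orders.\<close>

lemma breaks_less_plus_greater:
  fixes xs :: "'a::linorder list"
  assumes "distinct xs" "xs \<noteq> []"
  shows "breaks (<) xs + breaks (>) xs + 1 = length xs"
  using assms
  by (induction "(<) :: 'a \<Rightarrow> 'a \<Rightarrow> bool" xs rule: breaks.induct) auto

lemma breaks_sorted_wrt: "sorted_wrt R xs \<Longrightarrow> breaks R xs = 0"
  by (induction R xs rule: breaks.induct) auto

lemma sorted_wrt_subseq:
  assumes "subseq xs ys" "sorted_wrt R ys"
  shows "sorted_wrt R xs"
  using assms by (induction) (auto dest: subseq_set_subset)

text \<open>Parts taken from sorted blocks have no breaks, so breaks arise only at the seams between
  them.\<close>

lemma breaks_subseq_concat:
  assumes "subseq v (concat ps)" "\<forall>p\<in>set ps. sorted_wrt R p"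
  shows "breaks R v \<le> length ps - 1"
  using assms
proof (induction ps arbitrary: v)
  case (Cons p ps)
  obtain v1 v2 where v: "v = v1 @ v2" "subseq v1 p" "subseq v2 (concat ps)"
    using Cons.prems(1) by (auto elim: subseq_appendE)
  have "breaks R v1 = 0"
    using v(2) Cons.prems(2) by (auto intro: breaks_sorted_wrt sorted_wrt_subseq)
  moreover have "breaks R v2 \<le> length ps - 1"
    using Cons v by auto
  \<comment> \<open>The last block has no seam after it; ignoring this would make the bound off by
    one.\<close>
  moreover have "v2 = []" if "ps = []"
    using v that by simp
  ultimately show ?case
    using breaks_append_le[of R v1 v2] v(1) by (cases ps) auto
qed (auto dest: list_emb_length)

text \<open>If the part \<open>v1\<close> in the increasing blocks stays within the first
  \<open>p\<close>, then \<open>rev p @ p\<close> is left for the decreasing ones. If it goes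
  further, its only break is spent on the repeated \<open>last p\<close>, so \<open>p\<close> is
  increasing and \<open>v1\<close> cannot exhaust \<open>rev p\<close>; the remaining
  \<open>hd p # p\<close> already has too many breaks.\<close>

lemma two_increasing_decreasing_avoid:
  fixes p q :: "'a::linorder list"
  assumes "distinct p" "length p \<ge> 2" "sorted_wrt (<) q"
  shows "\<not> subseq (p @ rev p @ p) (concat ([q, q] @ replicate (length p) (rev q)))"
proof
  assume "subseq (p @ rev p @ p) (concat ([q, q] @ replicate (length p) (rev q)))"
  then obtain v1 v2 where v: "p @ rev p @ p = v1 @ v2" "subseq v1 (concat [q, q])"
    "subseq v2 (concat (replicate (length p) (rev q)))"
    unfolding concat_append by (blast elim: subseq_appendE)
  have p: "p \<noteq> []" "rev p \<noteq> []"
    using assms(2) by auto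
  have sum: "breaks (<) p + breaks (>) p + 1 = length p"
    using breaks_less_plus_greater assms(1) p by blast
  have less: "breaks (<) v1 \<le> 1"
    using breaks_subseq_concat[OF v(2), of "(<)"] assms(3) by simp
  have greater: "breaks (>) v2 \<le> length p - 1"
    using breaks_subseq_concat[OF v(3), of "(>)"] assms(3) by (auto simp: sorted_wrt_rev)
  have small: "breaks (>) v \<le> length p - 1" if "v2 = u @ v" for u v
    using breaks_append_ge[of "(>)" u v] greater that by simp
  show False
  proof (cases "length v1 \<le> length p")
    case True
    then obtain u where "v2 = u @ rev p @ p"
      using v(1) by (metis append_eq_append_conv_if)
    then have "breaks (>) (rev p @ p) \<le> length p - 1"
      by (rule small)
    \<comment> \<open>The repeated \<open>hd p\<close> in the middle adds one break, for a total of
      \<open>breaks (<) p + 1 + breaks (>) p = length p\<close>.\<close>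
    then show False
      using sum p by (simp add: breaks_append breaks_rev last_rev)
  next
    case False
    define u where "u = drop (length p) v1"
    have u: "v1 = p @ u" "u \<noteq> []" "rev p @ p = u @ v2"
      using v(1) False append_take_drop_id[of "length p" v1] unfolding u_def
      by (auto simp: append_eq_append_conv_if[of p] simp del: append_take_drop_id)
    \<comment> \<open>Equal letters meet at this seam and use up the one break allowed to
      \<open>v1\<close>.\<close>
    then have "hd u = last p"
      using p by (metis hd_append2 hd_rev)
    then have br: "breaks (<) v1 = breaks (<) p + 1 + breaks (<) u"
      using u p by (simp add: breaks_append)
    then have asc: "breaks (<) p = 0" "breaks (<) u = 0"
      using less by auto
    have "length u < length p"
    proof (rule ccontr)
      assume "\<not> length u < length p"
      then obtain u' where "u = rev p @ u'"
        using u(3)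
        by (auto simp: append_eq_append_conv_if intro: append_take_drop_id[symmetric] dest!: sym[of "rev p"])
      \<comment> \<open>If \<open>p\<close> and \<open>rev p\<close> both had no break for
        \<open><\<close>, then \<open>length p\<close> would be 1.\<close>
      then have "breaks (>) p = 0"
        using breaks_append_ge[of "(<)" "rev p" u'] asc by (simp add: breaks_rev)
      then show False
        using sum asc assms(2) by simp
    qed
    moreover have "rev p = rev (tl p) @ [hd p]"
      using p by (metis list.collapse rev.simps(2))
    ultimately have "v2 = drop (length u) (rev (tl p)) @ [hd p] @ p"
      using append_eq_append_conv_if[of u v2 "rev (tl p)" "[hd p] @ p"] u(3) by simp
    \<comment> \<open>The repeated \<open>hd p\<close> adds one break to the
      \<open>length p - 1\<close> breaks of the increasing \<open>p\<close>.\<close>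
    then have "breaks (>) ([hd p] @ p) \<le> length p - 1"
      by (rule small)
    then show False
      using sum asc p by (cases p) auto
  qed
qed

section \<open>Formation width\<close>

lemma exists_renaming:
  assumes "distinct t" "distinct v" "length t = length v"
  shows "\<exists>f. inj_on f (set t) \<and> map f t = v"
proof -
  define f where "f = (\<lambda>x. the (map_of (zip t v) x))"
  have "map f t = v"
    using assms by (intro nth_equalityI) (auto simp: f_def map_of_zip_nth)
  then show ?thesis
    using assms(2) by (metis distinct_map)
qed

text \<open>Injectivity of the renaming forces the three pieces of the preimage to be
  \<open>t\<close>, \<open>rev t\<close>, \<open>t\<close>, so renamings can be forgotten.\<close>

lemma seq_contains_IDI_iff:
  "seq_contains w (I_seq c @ D_seq c @ I_seq c) \<longleftrightarrow>
    (\<exists>t. distinct t \<and> length t = c \<and> subseq (t @ rev t @ t) w)"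
proof
  assume "seq_contains w (I_seq c @ D_seq c @ I_seq c)"
  then obtain t f where t: "subseq t w" "inj_on f (set t)" "map f t = I_seq c @ D_seq c @ I_seq c"
    by (auto simp: seq_contains_def)
  then obtain t1 t2 t3 where t': "t = t1 @ t2 @ t3"
    "map f t1 = I_seq c" "map f t2 = D_seq c" "map f t3 = I_seq c"
    by (metis map_eq_append_conv)
  have "map f t2 = map f (rev t1)"
    using t' by (simp add: I_seq_def D_seq_def flip: rev_map)
  then have "t2 = rev t1"
    by (rule map_inj_on) (rule inj_on_subset[OF t(2)], auto simp: t'(1))
  moreover have "map f t3 = map f t1"
    using t' by simp
  then have "t3 = t1"
    by (rule map_inj_on) (rule inj_on_subset[OF t(2)], auto simp: t'(1))
  moreover have "distinct t1"
    using t'(2) distinct_map[of f t1] by (simp only: I_seq_def distinct_upt simp_thms)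
  moreover have "length t1 = c"
    using arg_cong[OF t'(2), of length] by (simp add: I_seq_def)
  ultimately show "\<exists>t. distinct t \<and> length t = c \<and> subseq (t @ rev t @ t) w"
    using t t' by auto
next
  assume "\<exists>t. distinct t \<and> length t = c \<and> subseq (t @ rev t @ t) w"
  then obtain t where t: "distinct t" "length t = c" "subseq (t @ rev t @ t) w"
    by blast
  have "distinct (I_seq c)" "length t = length (I_seq c)"
    using t(2) by (simp_all add: I_seq_def del: upt_Suc)
  then obtain f where f: "inj_on f (set t)" "map f t = I_seq c"
    using exists_renaming t(1) by metis
  then have "map f (rev t) = D_seq c"
    by (simp add: D_seq_def I_seq_def flip: rev_map)
  then show "seq_contains w (I_seq c @ D_seq c @ I_seq c)"
    unfolding seq_contains_def using t f by (intro exI[of _ "t @ rev t @ t"] exI[of _ f]) auto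
qed

lemma formation_contains_IDI:
  assumes "c \<ge> 1"
  shows "\<exists>r. \<forall>w. is_formation r (c + 3) w \<longrightarrow> seq_contains w (I_seq c @ D_seq c @ I_seq c)"
proof -
  obtain r where r: "\<And>(A::nat set) ps. finite A \<Longrightarrow> r \<le> card A \<Longrightarrow> length ps = c + 3 \<Longrightarrow>
      set ps \<subseteq> permutations_of_set A \<Longrightarrow>
      \<exists>q. distinct q \<and> length q = c \<and> set q \<subseteq> A \<and> (\<forall>p\<in>set ps. subseq q p \<or> subseq (rev q) p)"
    using monotone_restriction[where 'a = nat, of "c + 3" c] by metis
  have "seq_contains w (I_seq c @ D_seq c @ I_seq c)" if w: "is_formation r (c + 3) w" for w
  proof -
    obtain A ps where A: "finite A" "card A = r" "length ps = c + 3"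
      "set ps \<subseteq> permutations_of_set A" "w = concat ps"
      using w by (auto simp: is_formation_def)
    obtain q where q: "distinct q" "length q = c" "\<forall>p\<in>set ps. subseq q p \<or> subseq (rev q) p"
      using r[of A ps] A by auto
    \<comment> \<open>Where \<open>q\<close> does not embed, \<open>rev q\<close> does, so either
      Boolean value is realised by a subsequence.\<close>
    define bs where "bs = map (\<lambda>p. subseq q p) ps"
    have "list_all2 subseq (map (\<lambda>b. if b then q else rev q) bs) ps"
      using q(3) by (auto simp: bs_def list_all2_conv_all_nth)
    then have sub: "subseq (binary_formation q bs) w"
      unfolding binary_formation_def A(5) by (rule subseq_concat_mono)
    obtain t where t: "mset t = mset q" "subseq (t @ rev t @ t) (binary_formation q bs)"
      using binary_formation_contains[of bs q] assms A q
      by (metis bs_def length_map list.size(3) not_one_le_zero)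
    have "distinct t" "length t = c"
      using t(1) q mset_eq_imp_distinct_iff mset_eq_length by blast+
    moreover have "subseq (t @ rev t @ t) w"
      using t(2) sub by (rule subseq_order.order_trans)
    ultimately show ?thesis
      unfolding seq_contains_IDI_iff by blast
  qed
  then show ?thesis
    by blast
qed

lemma exists_formation_avoiding_IDI:
  assumes "c \<ge> 2" "s < c + 3"
  shows "\<exists>w. is_formation r s w \<and> \<not> seq_contains w (I_seq c @ D_seq c @ I_seq c)"
proof -
  \<comment> \<open>The list has \<open>c + 2\<close> blocks; its prefixes serve all
    \<open>s < c + 3\<close> at once, as containment passes from a prefix to the whole.\<close>
  define ps where "ps = [[0..<r], [0..<r]] @ replicate c (rev [0..<r])"
  have "set ps \<subseteq> permutations_of_set {0..<r}"
    by (auto simp: ps_def permutations_of_set_def)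
  then have "set (take s ps) \<subseteq> permutations_of_set {0..<r}"
    using set_take_subset by (rule subset_trans[rotated])
  moreover have "length (take s ps) = s"
    using assms by (simp add: ps_def)
  ultimately have "is_formation r s (concat (take s ps))"
    unfolding is_formation_def by (intro exI[of _ "{0..<r}"] exI[of _ "take s ps"]) simp
  moreover have "\<not> seq_contains (concat (take s ps)) (I_seq c @ D_seq c @ I_seq c)"
    unfolding seq_contains_IDI_iff
  proof safe
    fix t
    assume t: "distinct t" "c = length t" "subseq (t @ rev t @ t) (concat (take s ps))"
    have "subseq (t @ rev t @ t) (concat (take s ps) @ concat (drop s ps))"
      using t(3) by (rule subseq_rev_drop_many)
    then have "subseq (t @ rev t @ t) (concat ps)"
      by (simp flip: concat_append)
    then show False
      using two_increasing_decreasing_avoid[of t "[0..<r]"] t assms(1) by (simp add: ps_def)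
  qed
  ultimately show ?thesis
    by blast
qed

theorem theorem5p1:
  fixes c :: nat
  assumes "c \<ge> 2"
  shows "fw (I_seq c @ D_seq c @ I_seq c) = enat (c + 3)"
proof (rule antisym)
  show "fw (I_seq c @ D_seq c @ I_seq c) \<le> enat (c + 3)"
    unfolding fw_def using formation_contains_IDI[of c] assms by (intro Inf_lower CollectI) simp
  show "enat (c + 3) \<le> fw (I_seq c @ D_seq c @ I_seq c)"
    unfolding fw_def
  proof (rule Inf_greatest)
    fix n
    assume "n \<in> {enat s | s. \<exists>r. \<forall>w. is_formation r s w \<longrightarrow>
      seq_contains w (I_seq c @ D_seq c @ I_seq c)}"
    then obtain s r where n: "n = enat s"
      and r: "\<forall>w. is_formation r s w \<longrightarrow> seq_contains w (I_seq c @ D_seq c @ I_seq c)"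
      by blast
    have "\<not> s < c + 3"
      using exists_formation_avoiding_IDI[OF assms] r by blast
    then show "enat (c + 3) \<le> n"
      by (simp add: n)
  qed
qed

end
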